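(* Let $f_1,\dots,f_M:\mathbb{R}^n\to\mathbb{R}^n$ define the switched system $x_{k+1}=f_{\sigma(k)}(x_k)$, $k\in\mathbb{N}$, let $c:\mathbb{R}^n\to\mathbb{R}_{\ge 0}$ be a cost function, and let $J:\mathbb{R}^n\to[0,+\infty]$ be the associated value function. Let $\mathcal{G}=(\mathcal{S},\mathcal{E})$ be a directed labeled graph with labels in $\{1,\dots,M\}$, and let $\mathcal{T}$ be a set of functions from $\mathbb{R}^n$ to $\mathbb{R}_{\ge0}$. Assume that $\{V_\alpha\}_{\alpha\in\mathcal{S}}\subseteq\mathcal{T}$ satisfies $$V_\alpha(x)\ge c(x)+V_\beta(f_i(x)),\qquad \forall x\in\mathbb{R}^n,\ \forall(\alpha,\beta,i)\in\mathcal{E}.$$ Then: (a) if $\mathcal{G}$ is complete for $\{1,\dots,M\}$, the function $V(x):=\min_{\alpha\in\mathcal{S}}V_\alpha(x)$ satisfies $V(x)\ge J(x)$ for all $x\in\mathbb{R}^n$; (b) if $\mathcal{G}$ is co-complete for $\{1,\dots,M\}$, the function $V(x):=\max_{\alpha\in\mathcal{S}}V_\alpha(x)$ satisfies $V(x)\ge J(x)$ for all $x\in\mathbb{R}^n$.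
   Context: $\mathbb{N}$ includes $0$ and $M\ge1$. A switching signal is any function $\sigma:\mathbb{N}\to\{1,\dots,M\}$. For $x\in\mathbb{R}^n$, $\xi(\cdot,x,\sigma)$ denotes the solution with $\xi(0,x,\sigma)=x$ and $\xi(k+1,x,\sigma)=f_{\sigma(k)}(\xi(k,x,\sigma))$. The cost-to-go is $J_\sigma(x)=\sum_{k=0}^\infty c(\xi(k,x,\sigma))\in[0,+\infty]$ ($+\infty$ if the series diverges), and the value function is $J(x)=\sup_{\sigma:\mathbb{N}\to\{1,\dots,M\}}J_\sigma(x)$. A directed labeled graph $\mathcal{G}=(\mathcal{S},\mathcal{E})$ consists of a finite (nonempty) set $\mathcal{S}$ of nodes and a set $\mathcal{E}\subseteq\mathcal{S}\times\mathcal{S}\times\{1,\dots,M\}$ of labeled edges; $(\alpha,\beta,i)$ is an edge from $\alpha$ to $\beta$ with label $i$. $\mathcal{G}$ is complete if for each $\alpha\in\mathcal{S}$ and each $i\in\{1,\dots,M\}$ there is at least one $\beta\in\mathcal{S}$ with $(\alpha,\beta,i)\in\mathcal{E}$. $\mathcal{G}$ is co-complete if for each $\beta\in\mathcal{S}$ and each $i\in\{1,\dots,M\}$ there is at least one $\alpha\in\mathcal{S}$ with $(\alpha,\beta,i)\in\mathcal{E}$. *)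

theory Defs
  imports "HOL-Analysis.Analysis"
begin

definition switching_signals :: "nat \<Rightarrow> (nat \<Rightarrow> nat) set" where
  "switching_signals M = {\<sigma>. \<forall>k. \<sigma> k \<in> {1..M}}"

primrec solution ::
  "(nat \<Rightarrow> real ^ 'n \<Rightarrow> real ^ 'n) \<Rightarrow> nat \<Rightarrow> real ^ 'n \<Rightarrow> (nat \<Rightarrow> nat) \<Rightarrow> real ^ 'n"
where
  "solution f 0 x \<sigma> = x"
| "solution f (Suc k) x \<sigma> = f (\<sigma> k) (solution f k x \<sigma>)"

(* The series is taken in ennreal, so it is \<infinity> exactly when the real series diverges;
   ennreal truncates negative reals to 0, so c is meant to be nonnegative. *)
definition cost_to_go ::
  "(nat \<Rightarrow> real ^ 'n \<Rightarrow> real ^ 'n) \<Rightarrow> (real ^ 'n \<Rightarrow> real) \<Rightarrow> (nat \<Rightarrow> nat) \<Rightarrow> real ^ 'n \<Rightarrow> ennreal"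
where
  "cost_to_go f c \<sigma> x = (\<Sum>k. ennreal (c (solution f k x \<sigma>)))"

definition value_function ::
  "nat \<Rightarrow> (nat \<Rightarrow> real ^ 'n \<Rightarrow> real ^ 'n) \<Rightarrow> (real ^ 'n \<Rightarrow> real) \<Rightarrow> real ^ 'n \<Rightarrow> ennreal"
where
  "value_function M f c x = (SUP \<sigma>\<in>switching_signals M. cost_to_go f c \<sigma> x)"

(* (\<alpha>, \<beta>, i) \<in> E is an edge from \<alpha> to \<beta> with label i. *)
definition labeled_graph :: "nat \<Rightarrow> 's set \<Rightarrow> ('s \<times> 's \<times> nat) set \<Rightarrow> bool" where
  "labeled_graph M S E \<longleftrightarrow> finite S \<and> S \<noteq> {} \<and> E \<subseteq> S \<times> S \<times> {1..M}"

definition complete_graph :: "nat \<Rightarrow> 's set \<Rightarrow> ('s \<times> 's \<times> nat) set \<Rightarrow> bool" where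
  "complete_graph M S E \<longleftrightarrow> (\<forall>\<alpha>\<in>S. \<forall>i\<in>{1..M}. \<exists>\<beta>\<in>S. (\<alpha>, \<beta>, i) \<in> E)"

definition co_complete_graph :: "nat \<Rightarrow> 's set \<Rightarrow> ('s \<times> 's \<times> nat) set \<Rightarrow> bool" where
  "co_complete_graph M S E \<longleftrightarrow> (\<forall>\<beta>\<in>S. \<forall>i\<in>{1..M}. \<exists>\<alpha>\<in>S. (\<alpha>, \<beta>, i) \<in> E)"

end

theory Submission
  imports Defs
begin

text \<open>
  The graph enters only through one observation: completeness makes the pointwise minimum, and
  co-completeness the pointwise maximum, of the \<open>V \<alpha>\<close> a common function that decreases
  by at least the running cost under every mode. For the minimum, start an edge at a minimizing
  node of the current state; its target bounds the minimum at the next state from above. For the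
  maximum, end an edge at a maximizing node of the next state; its source bounds the maximum at
  the current state from below. In both cases the edge inequality then passes to the
  extremum (\<open>Min_cost_decrease\<close>, \<open>Max_cost_decrease\<close>).

  A nonnegative function \<open>W\<close> with \<open>W x \<ge> c x + W (f i x)\<close> for all modes \<open>i\<close> dominates
  the value function by telescoping along an arbitrary trajectory: the cost of the first \<open>m\<close>
  steps is at most \<open>W x\<close> minus the value of \<open>W\<close> at the state reached
  (\<open>value_function_le_of_cost_decrease\<close>).
\<close>

text \<open>The final term \<open>W (solution f m x \<sigma>)\<close> is kept in the bound because it is what pays
  for the cost of the next step.\<close>

lemma partial_cost_le:
  fixes f :: "nat \<Rightarrow> real ^ 'n \<Rightarrow> real ^ 'n" and W :: "real ^ 'n \<Rightarrow> real"
  assumes decrease: "\<And>i x. i \<in> {1..M} \<Longrightarrow> c x + W (f i x) \<le> W x"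
    and \<sigma>: "\<sigma> \<in> switching_signals M"
  shows "(\<Sum>k<m. c (solution f k x \<sigma>)) + W (solution f m x \<sigma>) \<le> W x"
proof (induction m)
  case 0
  show ?case by simp
next
  case (Suc m)
  have "c (solution f m x \<sigma>) + W (f (\<sigma> m) (solution f m x \<sigma>)) \<le> W (solution f m x \<sigma>)"
    using \<sigma> by (intro decrease) (simp add: switching_signals_def)
  with Suc show ?case by simp
qed

text \<open>Nonnegativity of \<open>W\<close> allows the final term of the telescoped bound to be dropped, so that
  all partial costs, and hence the series, lie below \<open>W x\<close>. In particular the series converges
  for every signal.\<close>

lemma value_function_le_of_cost_decrease:
  fixes f :: "nat \<Rightarrow> real ^ 'n \<Rightarrow> real ^ 'n" and W :: "real ^ 'n \<Rightarrow> real"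
  assumes c: "\<And>x. c x \<ge> 0"
    and W: "\<And>x. W x \<ge> 0"
    and decrease: "\<And>i x. i \<in> {1..M} \<Longrightarrow> c x + W (f i x) \<le> W x"
  shows "value_function M f c x \<le> ennreal (W x)"
  unfolding value_function_def cost_to_go_def suminf_eq_SUP
proof (intro SUP_least)
  fix \<sigma> m
  assume "\<sigma> \<in> switching_signals M"
  then have "(\<Sum>k<m. c (solution f k x \<sigma>)) + W (solution f m x \<sigma>) \<le> W x"
    by (intro partial_cost_le decrease)
  with W[of "solution f m x \<sigma>"] have "(\<Sum>k<m. c (solution f k x \<sigma>)) \<le> W x"
    by linarith
  then show "(\<Sum>k<m. ennreal (c (solution f k x \<sigma>))) \<le> ennreal (W x)"
    by (simp add: sum_ennreal c ennreal_leI)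
qed

text \<open>A minimizing node at \<open>x\<close> depends on \<open>x\<close> but not on the mode, so it must have an outgoing
  edge for every label; this is completeness.\<close>

lemma Min_cost_decrease:
  fixes V :: "'s \<Rightarrow> real ^ 'n \<Rightarrow> real"
  assumes S: "finite S" "S \<noteq> {}"
    and edge: "\<And>x \<alpha> \<beta> i. (\<alpha>, \<beta>, i) \<in> E \<Longrightarrow> V \<alpha> x \<ge> c x + V \<beta> (f i x)"
    and complete: "complete_graph M S E"
    and i: "i \<in> {1..M}"
  shows "c x + Min ((\<lambda>\<alpha>. V \<alpha> (f i x)) ` S) \<le> Min ((\<lambda>\<alpha>. V \<alpha> x) ` S)"
proof -
  have "Min ((\<lambda>\<alpha>. V \<alpha> x) ` S) \<in> (\<lambda>\<alpha>. V \<alpha> x) ` S"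
    using S by (intro Min_in) auto
  then obtain \<alpha> where \<alpha>: "\<alpha> \<in> S" "Min ((\<lambda>\<alpha>. V \<alpha> x) ` S) = V \<alpha> x"
    by blast
  obtain \<beta> where \<beta>: "\<beta> \<in> S" "(\<alpha>, \<beta>, i) \<in> E"
    using complete \<alpha>(1) i unfolding complete_graph_def by blast
  have "Min ((\<lambda>\<alpha>. V \<alpha> (f i x)) ` S) \<le> V \<beta> (f i x)"
    using S \<beta>(1) by (intro Min_le) auto
  with edge[OF \<beta>(2), of x] \<alpha>(2) show ?thesis by linarith
qed

text \<open>Dually, a maximizing node at \<open>f i x\<close> can be any node, so every node must have an incoming
  edge with label \<open>i\<close>; this is co-completeness.\<close>

lemma Max_cost_decrease:
  fixes V :: "'s \<Rightarrow> real ^ 'n \<Rightarrow> real"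
  assumes S: "finite S" "S \<noteq> {}"
    and edge: "\<And>x \<alpha> \<beta> i. (\<alpha>, \<beta>, i) \<in> E \<Longrightarrow> V \<alpha> x \<ge> c x + V \<beta> (f i x)"
    and co_complete: "co_complete_graph M S E"
    and i: "i \<in> {1..M}"
  shows "c x + Max ((\<lambda>\<alpha>. V \<alpha> (f i x)) ` S) \<le> Max ((\<lambda>\<alpha>. V \<alpha> x) ` S)"
proof -
  have "Max ((\<lambda>\<alpha>. V \<alpha> (f i x)) ` S) \<in> (\<lambda>\<alpha>. V \<alpha> (f i x)) ` S"
    using S by (intro Max_in) auto
  then obtain \<beta> where \<beta>: "\<beta> \<in> S" "Max ((\<lambda>\<alpha>. V \<alpha> (f i x)) ` S) = V \<beta> (f i x)"
    by blast
  obtain \<alpha> where \<alpha>: "\<alpha> \<in> S" "(\<alpha>, \<beta>, i) \<in> E"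
    using co_complete \<beta>(1) i unfolding co_complete_graph_def by blast
  have "V \<alpha> x \<le> Max ((\<lambda>\<alpha>. V \<alpha> x) ` S)"
    using S \<alpha>(1) by (intro Max_ge) auto
  with edge[OF \<alpha>(2), of x] \<beta>(2) show ?thesis by linarith
qed

theorem theorem1:
  fixes M :: nat
    and f :: "nat \<Rightarrow> real ^ 'n \<Rightarrow> real ^ 'n"
    and c :: "real ^ 'n \<Rightarrow> real"
    and S :: "'s set"
    and E :: "('s \<times> 's \<times> nat) set"
    and T :: "(real ^ 'n \<Rightarrow> real) set"
    and V :: "'s \<Rightarrow> real ^ 'n \<Rightarrow> real"
  assumes "M \<ge> 1"
    and "\<And>x. c x \<ge> 0"
    and "labeled_graph M S E"
    and "\<And>v x. v \<in> T \<Longrightarrow> v x \<ge> 0"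
    and "\<And>\<alpha>. \<alpha> \<in> S \<Longrightarrow> V \<alpha> \<in> T"
    and "\<And>x \<alpha> \<beta> i. (\<alpha>, \<beta>, i) \<in> E \<Longrightarrow> V \<alpha> x \<ge> c x + V \<beta> (f i x)"
  shows "(complete_graph M S E \<longrightarrow>
            (\<forall>x. ennreal (Min ((\<lambda>\<alpha>. V \<alpha> x) ` S)) \<ge> value_function M f c x)) \<and>
         (co_complete_graph M S E \<longrightarrow>
            (\<forall>x. ennreal (Max ((\<lambda>\<alpha>. V \<alpha> x) ` S)) \<ge> value_function M f c x))"
proof (intro conjI impI allI)
  have S: "finite S" "S \<noteq> {}"
    using assms(3) by (auto simp: labeled_graph_def)
  have V: "V \<alpha> x \<ge> 0" if "\<alpha> \<in> S" for \<alpha> x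
    using assms(4,5) that by blast
  fix x
  show "value_function M f c x \<le> ennreal (Min ((\<lambda>\<alpha>. V \<alpha> x) ` S))" if "complete_graph M S E"
  proof (rule value_function_le_of_cost_decrease[where W = "\<lambda>x. Min ((\<lambda>\<alpha>. V \<alpha> x) ` S)"])
    show "0 \<le> Min ((\<lambda>\<alpha>. V \<alpha> y) ` S)" for y
      using S V by simp
    show "c y + Min ((\<lambda>\<alpha>. V \<alpha> (f i y)) ` S) \<le> Min ((\<lambda>\<alpha>. V \<alpha> y) ` S)"
      if "i \<in> {1..M}" for i y
      using S assms(6) \<open>complete_graph M S E\<close> that by (rule Min_cost_decrease)
  qed (rule assms(2))
  show "value_function M f c x \<le> ennreal (Max ((\<lambda>\<alpha>. V \<alpha> x) ` S))" if "co_complete_graph M S E"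
  proof (rule value_function_le_of_cost_decrease[where W = "\<lambda>x. Max ((\<lambda>\<alpha>. V \<alpha> x) ` S)"])
    show "0 \<le> Max ((\<lambda>\<alpha>. V \<alpha> y) ` S)" for y
      using S V by (auto simp: Max_ge_iff)
    show "c y + Max ((\<lambda>\<alpha>. V \<alpha> (f i y)) ` S) \<le> Max ((\<lambda>\<alpha>. V \<alpha> y) ` S)"
      if "i \<in> {1..M}" for i y
      using S assms(6) \<open>co_complete_graph M S E\<close> that by (rule Max_cost_decrease)
  qed (rule assms(2))
qed

end
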